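(* Let $X$ be a 0DMC space, and $f:X\to X$ be a partial continuous injection. (a) If the domain of $f$ is open, then $\chi_c(X,G_f)\in\omega\cup\{2^{\aleph_0}\}$, and all these values are possible with fixed point free partial homeomorphisms (with open domain) on a countable (0DMC) space. (b) If the domain of $f$ is closed, then $\chi_c(X,G_f)\in\{0,1,2,3,2^{\aleph_0}\}$, and all these values are possible with (total) homeomorphisms of a countable (0DMC) space. Moreover, there are a countable Polish space $X$ and a fixed point free partial homeomorphism $f:X\to X$ with open domain such that $\chi_c(X,G_f)=\aleph_0$.
   Context: A space is 0DMC if it is zero-dimensional (has a basis of clopen sets), metrizable and compact. A partial function $f:X\to X$ is a function from $\mathrm{Domain}(f)\subseteq X$ onto $\mathrm{Range}(f)\subseteq X$; a partial homeomorphism is a partial function which is a homeomorphism from its domain onto its range; $f$ is fixed point free if $f(x)\neq x$ for all $x\in\mathrm{Domain}(f)$. The graph induced by $f$ is $G_f=\big(\mathrm{Graph}(f)\cup\mathrm{Graph}(f)^{-1}\big)\setminus\Delta(X)$, where $\Delta(X)$ is the diagonal. A coloring of $G_f$ is a map $c$ on $X$ with $c(x)\neq c(y)$ whenever $(x,y)\in G_f$. The continuous chromatic number $\chi_c(X,G_f)$ is the least cardinal $\kappa\leq\aleph_0$ for which there is a continuous coloring $c:X\to\kappa$ ($\kappa$ discrete) if it exists, and $2^{\aleph_0}$ otherwise. Countable means finite or countably infinite. *)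

theory Defs
  imports "HOL-Analysis.Analysis"
begin

unbundle cardinal_syntax

definition zero_dimensional_space :: "'a topology \<Rightarrow> bool" where
  "zero_dimensional_space X \<longleftrightarrow>
     (\<exists>\<B>. (\<forall>U\<in>\<B>. openin X U \<and> closedin X U) \<and>
          openin X = arbitrary union_of (\<lambda>U. U \<in> \<B>))"

definition zdmc_space :: "'a topology \<Rightarrow> bool" where
  "zdmc_space X \<longleftrightarrow> zero_dimensional_space X \<and> metrizable_space X \<and> compact_space X"

definition Polish_space :: "'a topology \<Rightarrow> bool" where
  "Polish_space X \<longleftrightarrow> separable_space X \<and> completely_metrizable_space X"

definition partial_function_on :: "'a topology \<Rightarrow> ('a \<rightharpoonup> 'a) \<Rightarrow> bool" where
  "partial_function_on X f \<longleftrightarrow> dom f \<subseteq> topspace X \<and> ran f \<subseteq> topspace X"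

definition partial_continuous_injection :: "'a topology \<Rightarrow> ('a \<rightharpoonup> 'a) \<Rightarrow> bool" where
  "partial_continuous_injection X f \<longleftrightarrow>
     partial_function_on X f \<and> inj_on f (dom f) \<and>
     continuous_map (subtopology X (dom f)) X (the \<circ> f)"

definition partial_homeomorphism :: "'a topology \<Rightarrow> ('a \<rightharpoonup> 'a) \<Rightarrow> bool" where
  "partial_homeomorphism X f \<longleftrightarrow>
     partial_function_on X f \<and>
     homeomorphic_map (subtopology X (dom f)) (subtopology X (ran f)) (the \<circ> f)"

definition total_homeomorphism :: "'a topology \<Rightarrow> ('a \<rightharpoonup> 'a) \<Rightarrow> bool" where
  "total_homeomorphism X f \<longleftrightarrow>
     partial_homeomorphism X f \<and> dom f = topspace X \<and> ran f = topspace X"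

definition fixed_point_free :: "('a \<rightharpoonup> 'a) \<Rightarrow> bool" where
  "fixed_point_free f \<longleftrightarrow> (\<forall>x\<in>dom f. f x \<noteq> Some x)"

definition induced_graph :: "'a topology \<Rightarrow> ('a \<rightharpoonup> 'a) \<Rightarrow> 'a rel" where
  "induced_graph X f = (Map.graph f \<union> (Map.graph f)\<inverse>) - Id_on (topspace X)"

definition continuous_coloring :: "'a topology \<Rightarrow> 'a rel \<Rightarrow> 'k set \<Rightarrow> ('a \<Rightarrow> 'k) \<Rightarrow> bool" where
  "continuous_coloring X G K c \<longleftrightarrow>
     continuous_map X (discrete_topology K) c \<and> (\<forall>(x, y)\<in>G. c x \<noteq> c y)"

abbreviation continuum :: "(nat \<Rightarrow> bool) rel" where
  "continuum \<equiv> ctwo ^c natLeq"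

definition coloring_cardinals :: "'a topology \<Rightarrow> 'a rel \<Rightarrow> (nat \<Rightarrow> bool) rel set" where
  "coloring_cardinals X G =
     {\<kappa>. Card_order \<kappa> \<and> \<kappa> \<le>o natLeq \<and> (\<exists>c. continuous_coloring X G (Field \<kappa>) c)}"

(* Cardinals are cardinal orders, identified up to =o. All of them are represented on the
   carrier type of the continuum, which has room for every cardinal up to that one.
   Cardinals being well-ordered, the SOME below picks a least one, unique up to =o. *)
definition continuous_chromatic_number :: "'a topology \<Rightarrow> 'a rel \<Rightarrow> (nat \<Rightarrow> bool) rel"
    (\<open>\<chi>\<^sub>c\<close>) where
  "\<chi>\<^sub>c X G =
     (if coloring_cardinals X G = {} then continuum
      else SOME \<kappa>. \<kappa> \<in> coloring_cardinals X G \<and> (\<forall>\<mu>\<in>coloring_cardinals X G. \<kappa> \<le>o \<mu>))"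

end

theory Submission
  imports Defs
begin

text \<open>
  On a compact space a continuous coloring by natural numbers takes finitely many values. Hence the
  continuous chromatic number of a graph on a 0DMC space is either finite or the continuum, which
  is the dichotomy in (a).

  If the domain of \<open>f\<close> is closed, then any continuous coloring can be replaced by one with
  three colors (\<open>colorable_three\<close>). The graph has degree at most two, so the finitely many
  classes of the given coloring can be recolored greedily, one class at a time. The neighbors of a
  closed set form a closed set (\<open>closedin_neighbors\<close>), so every color is allowed on an open
  part of the class, and zero-dimensionality turns the cover by these open parts into a clopen
  partition (\<open>clopen_selection\<close>).

  The values that need topology are realized on sums of convergent sequences
  (\<open>sequences I\<close>). A continuous coloring is constant near each limit, so two limits get
  different colors as soon as the graph joins their sequences arbitrarily far out
  (\<open>coloring_separates_limits\<close>). Matching isolated points so that every two of the sequences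
  are joined in this way behaves like a complete graph on the limits: the chromatic number is the
  number of sequences. This gives every finite value on compact spaces, and
  \<open>\<aleph>\<^sub>0\<close> on the sum of infinitely many sequences, which is Polish but not
  compact. Joining a single convergent sequence to itself infinitely often excludes all continuous
  colorings; exchanging consecutive terms does this by a total homeomorphism, and by a fixed point
  free one if it is restricted to every other term. The values up to three in (b) are attained by
  finite cycles.
\<close>

section \<open>From colorings to the chromatic number\<close>

text \<open>The relation \<open>\<chi>\<^sub>c\<close> lives on the carrier of the continuum, but its
  value is decided by colorings into sets of natural numbers, since all cardinals up to
  \<open>\<aleph>\<^sub>0\<close> are represented there.\<close>
definition colorable :: "'a topology \<Rightarrow> 'a rel \<Rightarrow> nat set \<Rightarrow> bool" where
  "colorable X G K \<longleftrightarrow> (\<exists>c. continuous_coloring X G K c)"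

text \<open>Colors may be renamed injectively. It suffices that the renaming is injective on the colors
  that occur: in a discrete space the set of these colors carries the discrete topology, so
  every map on it is continuous.\<close>
lemma continuous_coloring_recolor:
  assumes c: "continuous_coloring X G K c"
    and h: "inj_on h (c ` topspace X)" "h ` c ` topspace X \<subseteq> L"
    and G: "G \<subseteq> topspace X \<times> topspace X"
  shows "continuous_coloring X G L (h \<circ> c)"
proof -
  have "continuous_map X (subtopology (discrete_topology K) (c ` topspace X)) c"
    using c by (subst continuous_map_in_subtopology) (auto simp: continuous_coloring_def)
  moreover have "continuous_map (subtopology (discrete_topology K) (c ` topspace X))
      (discrete_topology L) h"
    using h(2) by auto
  ultimately have "continuous_map X (discrete_topology L) (h \<circ> c)"
    by (rule continuous_map_compose)
  moreover have "(h \<circ> c) x \<noteq> (h \<circ> c) y" if "(x, y) \<in> G" for x y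
  proof -
    have "c x \<noteq> c y" "x \<in> topspace X" "y \<in> topspace X"
      using c G that by (auto simp: continuous_coloring_def)
    then show ?thesis using h(1) by (auto simp: inj_on_def)
  qed
  ultimately show ?thesis
    by (auto simp: continuous_coloring_def)
qed

lemma continuous_coloring_range:
  "continuous_coloring X G K c \<Longrightarrow> c ` topspace X \<subseteq> K"
  using continuous_map_image_subset_topspace by (force simp: continuous_coloring_def)

lemma colorable_if_card_of_le:
  assumes c: "continuous_coloring X G K c" and le: "|K| \<le>o |L|"
    and G: "G \<subseteq> topspace X \<times> topspace X"
  shows "colorable X G L"
proof -
  obtain h where "inj_on h K" "h ` K \<subseteq> L"
    using le card_of_ordLeq by metis
  moreover note continuous_coloring_range[OF c]
  ultimately have "inj_on h (c ` topspace X)" "h ` c ` topspace X \<subseteq> L"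
    by (auto intro: inj_on_subset)
  then have "continuous_coloring X G L (h \<circ> c)"
    by (rule continuous_coloring_recolor[OF c _ _ G])
  then show ?thesis by (auto simp: colorable_def)
qed

lemma card_of_ordLeq_lessThan:
  assumes "finite A"
  shows "|A| \<le>o |{..<card A}|"
  using ex_bij_betw_finite_nat[OF assms] card_of_ordIsoI ordIso_imp_ordLeq
  by (fastforce simp: atLeast0LessThan)

lemma natLeq_on_ordIso_card_of:
  assumes "finite A"
  shows "natLeq_on (card A) =o |A|"
proof -
  have "natLeq_on (card A) =o |{x. x < card A}|"
    by (rule finite_well_order_on_ordIso[OF finite_Collect_less_nat natLeq_on_well_order_on
          card_of_well_order_on])
  moreover have "|{x. x < card A}| =o |A|"
    using ex_bij_betw_nat_finite[OF assms] card_of_ordIsoI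
    by (fastforce simp: atLeast0LessThan lessThan_def)
  ultimately show ?thesis by (rule ordIso_transitive)
qed

lemma Card_order_natLeq_on: "Card_order (natLeq_on n)"
  using Card_order_ordIso[OF card_of_Card_order natLeq_on_ordIso_card_of[of "{..<n}"]] by simp

text \<open>The chromatic number is a choice among least elements, hence is determined only up to
  \<open>=o\<close>. A cardinal \<open>r\<close> on the natural numbers is first copied to the carrier
  \<open>nat \<Rightarrow> bool\<close> along the injection that sends \<open>n\<close> to the
  indicator function of \<open>{n}\<close>; the copy is then itself an admissible number of colors, and it is
  comparable in both directions with the chosen one.\<close>
lemma continuous_chromatic_number_eqI:
  fixes r :: "nat rel"
  assumes r: "Card_order r" "colorable X G (Field r)" "G \<subseteq> topspace X \<times> topspace X"
    and least: "\<And>\<kappa>. \<kappa> \<in> coloring_cardinals X G \<Longrightarrow> r \<le>o \<kappa>"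
  shows "\<chi>\<^sub>c X G =o r"
proof -
  have "|Field r| \<le>o |UNIV :: nat set|" by (simp add: card_of_mono1)
  then have "r \<le>o natLeq"
    using card_of_Field_ordIso[OF r(1)] card_of_nat
    by (meson ordIso_ordLeq_trans ordIso_symmetric ordLeq_ordIso_trans)
  define e :: "nat \<Rightarrow> nat \<Rightarrow> bool" where "e = (=)"
  have e: "inj e" by (auto simp: e_def inj_def fun_eq_iff)
  define \<kappa> where "\<kappa> = |e ` Field r|"
  have "|Field r| =o |e ` Field r|"
    using e by (intro card_of_ordIsoI[of e]) (auto simp: bij_betw_def intro: inj_on_subset)
  with r(1) have iso: "\<kappa> =o r"
    unfolding \<kappa>_def by (meson card_of_Field_ordIso ordIso_symmetric ordIso_transitive)
  obtain c where c: "continuous_coloring X G (Field r) c"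
    using r(2) by (auto simp: colorable_def)
  have "continuous_coloring X G (Field \<kappa>) (e \<circ> c)"
    using continuous_coloring_range[OF c] e
    by (intro continuous_coloring_recolor[OF c _ _ r(3)])
      (auto simp: \<kappa>_def Field_card_of inj_def inj_on_def)
  moreover have "\<kappa> \<le>o natLeq"
    using iso \<open>r \<le>o natLeq\<close> by (rule ordIso_ordLeq_trans)
  moreover have "Card_order \<kappa>" by (simp add: \<kappa>_def card_of_Card_order)
  ultimately have mem: "\<kappa> \<in> coloring_cardinals X G"
    by (auto simp: coloring_cardinals_def)
  have min: "\<kappa> \<in> coloring_cardinals X G \<and> (\<forall>\<mu>\<in>coloring_cardinals X G. \<kappa> \<le>o \<mu>)"
    using mem least iso ordIso_ordLeq_trans by blast
  define \<nu> where "\<nu> = \<chi>\<^sub>c X G"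
  have "\<nu> \<in> coloring_cardinals X G \<and> (\<forall>\<mu>\<in>coloring_cardinals X G. \<nu> \<le>o \<mu>)"
    unfolding \<nu>_def continuous_chromatic_number_def
    using someI[of "\<lambda>\<kappa>. \<kappa> \<in> coloring_cardinals X G \<and> (\<forall>\<mu>\<in>coloring_cardinals X G. \<kappa> \<le>o \<mu>)", OF min] mem
    by auto
  then have "\<nu> \<le>o r" "r \<le>o \<nu>"
    using mem iso least ordLeq_ordIso_trans by blast+
  then show ?thesis by (simp add: \<nu>_def ordIso_iff_ordLeq)
qed

lemma continuous_chromatic_number_finite:
  assumes "colorable X G {..<n}" and G: "G \<subseteq> topspace X \<times> topspace X"
    and least: "\<And>m. colorable X G {..<m} \<Longrightarrow> n \<le> m"
  shows "\<chi>\<^sub>c X G =o natLeq_on n"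
proof (rule continuous_chromatic_number_eqI[OF Card_order_natLeq_on _ G])
  show "colorable X G (Field (natLeq_on n))"
    using assms(1) by (simp add: Field_natLeq_on lessThan_def)
  fix \<kappa> :: "(nat \<Rightarrow> bool) rel" assume "\<kappa> \<in> coloring_cardinals X G"
  then obtain c where \<kappa>: "Card_order \<kappa>" and c: "continuous_coloring X G (Field \<kappa>) c"
    by (auto simp: coloring_cardinals_def)
  have F: "|Field \<kappa>| =o \<kappa>" using \<kappa> by (rule card_of_Field_ordIso)
  show "natLeq_on n \<le>o \<kappa>"
  proof (cases "finite (Field \<kappa>)")
    case True
    define m where "m = card (Field \<kappa>)"
    have "|Field \<kappa>| \<le>o |{..<m}|"
      using True unfolding m_def by (rule card_of_ordLeq_lessThan)
    then have "colorable X G {..<m}" using c G by (intro colorable_if_card_of_le)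
    then have "n \<le> m" by (rule least)
    have "natLeq_on n =o |{..<n}|"
      using natLeq_on_ordIso_card_of[of "{..<n}"] by simp
    also have "|{..<n}| \<le>o |{..<m}|"
      using \<open>n \<le> m\<close> by (intro card_of_mono1) auto
    also (ordIso_ordLeq_trans) have "|{..<m}| =o natLeq_on m"
      using natLeq_on_ordIso_card_of[of "{..<m}", THEN ordIso_symmetric] by simp
    also (ordLeq_ordIso_trans) have "natLeq_on m =o \<kappa>"
      using natLeq_on_ordIso_card_of[OF True] F unfolding m_def by (rule ordIso_transitive)
    finally (ordLeq_ordIso_trans) show ?thesis .
  next
    case False
    have "natLeq_on n <o |Field \<kappa>|"
      using False natLeq_on_Well_order card_of_Well_order
      by (rule_tac finite_ordLess_infinite) (simp_all add: Field_natLeq_on Field_card_of)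
    then have "natLeq_on n \<le>o |Field \<kappa>|" by (rule ordLess_imp_ordLeq)
    then show ?thesis using F by (rule ordLeq_ordIso_trans)
  qed
qed

lemma continuous_chromatic_number_countable:
  assumes "colorable X G UNIV" and G: "G \<subseteq> topspace X \<times> topspace X"
    and none: "\<And>m. \<not> colorable X G {..<m}"
  shows "\<chi>\<^sub>c X G =o natLeq"
proof (rule continuous_chromatic_number_eqI[OF natLeq_Card_order _ G])
  show "colorable X G (Field natLeq)"
    using assms(1) by (simp add: Field_natLeq)
  fix \<kappa> :: "(nat \<Rightarrow> bool) rel" assume "\<kappa> \<in> coloring_cardinals X G"
  then obtain c where \<kappa>: "Card_order \<kappa>" and c: "continuous_coloring X G (Field \<kappa>) c"
    by (auto simp: coloring_cardinals_def)
  have "infinite (Field \<kappa>)"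
  proof
    assume "finite (Field \<kappa>)"
    then have "|Field \<kappa>| \<le>o |{..<card (Field \<kappa>)}|"
      by (rule card_of_ordLeq_lessThan)
    with c G none show False using colorable_if_card_of_le by blast
  qed
  then show "natLeq \<le>o \<kappa>"
    using \<kappa> card_of_Field_ordIso infinite_iff_natLeq_ordLeq ordLeq_ordIso_trans by blast
qed

lemma continuous_chromatic_number_continuum:
  assumes "\<not> colorable X G UNIV" and G: "G \<subseteq> topspace X \<times> topspace X"
  shows "\<chi>\<^sub>c X G = continuum"
proof -
  have False if \<kappa>: "\<kappa> \<in> coloring_cardinals X G" for \<kappa>
  proof -
    obtain c where "Card_order \<kappa>" and le: "\<kappa> \<le>o natLeq"
        and c: "continuous_coloring X G (Field \<kappa>) c"
      using \<kappa> by (auto simp: coloring_cardinals_def)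
    have "|Field \<kappa>| \<le>o |UNIV :: nat set|"
      using \<open>Card_order \<kappa>\<close> le
      by (meson card_of_Field_ordIso card_of_nat ordIso_ordLeq_trans ordIso_symmetric
          ordLeq_ordIso_trans)
    then show False using assms c colorable_if_card_of_le by blast
  qed
  then show ?thesis by (auto simp: continuous_chromatic_number_def)
qed

lemma continuous_map_into_discrete_iff:
  "continuous_map X (discrete_topology K) c \<longleftrightarrow>
    c ` topspace X \<subseteq> K \<and> (\<forall>k\<in>K. openin X {x \<in> topspace X. c x = k})"
proof (intro iffI conjI ballI)
  assume c: "continuous_map X (discrete_topology K) c"
  then show "c ` topspace X \<subseteq> K" using continuous_map_image_subset_topspace by fastforce
  fix k assume "k \<in> K"
  then show "openin X {x \<in> topspace X. c x = k}"
    using openin_continuous_map_preimage[OF c, of "{k}"] by simp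
next
  assume R: "c ` topspace X \<subseteq> K \<and> (\<forall>k\<in>K. openin X {x \<in> topspace X. c x = k})"
  have "openin X {x \<in> topspace X. c x \<in> U}" if "U \<subseteq> K" for U
  proof -
    have "{x \<in> topspace X. c x \<in> U} = (\<Union>k\<in>U. {x \<in> topspace X. c x = k})" by auto
    moreover have "openin X (\<Union>k\<in>U. {x \<in> topspace X. c x = k})"
      using R that by (intro openin_Union) auto
    ultimately show ?thesis by simp
  qed
  then show "continuous_map X (discrete_topology K) c"
    using R by (auto simp: continuous_map_def)
qed

lemma induced_graph_subset:
  "partial_function_on X f \<Longrightarrow> induced_graph X f \<subseteq> topspace X \<times> topspace X"
  by (auto simp: induced_graph_def partial_function_on_def Map.graph_def dom_def ran_def)

lemma compact_space_colorable_finite: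
  assumes X: "compact_space X" and "colorable X G UNIV" and G: "G \<subseteq> topspace X \<times> topspace X"
  obtains n where "colorable X G {..<n}"
proof -
  obtain c :: "'a \<Rightarrow> nat" where c: "continuous_coloring X G UNIV c"
    using assms(2) by (auto simp: colorable_def)
  have "compactin (discrete_topology UNIV) (c ` topspace X)"
    using X c by (auto simp: continuous_coloring_def compact_space_def intro: image_compactin)
  then have "finite (c ` topspace X)" by (simp add: compactin_discrete_topology)
  then obtain n where "c ` topspace X \<subseteq> {..<n}"
    using finite_nat_iff_bounded by blast
  then have "continuous_coloring X G {..<n} (id \<circ> c)"
    by (intro continuous_coloring_recolor[OF c _ _ G]) auto
  then show ?thesis using that by (auto simp: colorable_def)
qed

section \<open>Three colors suffice when the domain is closed\<close>
lemma zero_dimensional_space_neighborhood: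
  assumes "zero_dimensional_space X" "openin X S" "x \<in> S"
  obtains B where "openin X B" "closedin X B" "x \<in> B" "B \<subseteq> S"
proof -
  obtain \<B> where \<B>: "\<forall>U\<in>\<B>. openin X U \<and> closedin X U"
      "openin X = arbitrary union_of (\<lambda>U. U \<in> \<B>)"
    using assms(1) by (auto simp: zero_dimensional_space_def)
  then obtain \<U> where "\<U> \<subseteq> \<B>" "\<Union>\<U> = S"
    using assms(2) by (auto simp: union_of_def)
  with that \<B>(1) assms(3) show ?thesis by blast
qed

text \<open>The reduction property of open covers of a clopen set in a compact zero-dimensional space:
  finitely many clopen sets that refine the cover suffice, and sending a point to the least index
  for which it is covered makes the pieces disjoint while keeping them clopen.\<close>
lemma clopen_selection:
  fixes Q :: "nat \<Rightarrow> 'a set"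
  assumes X: "zero_dimensional_space X" "compact_space X"
    and U: "openin X U" "closedin X U"
    and Q: "\<And>j. j < n \<Longrightarrow> openin X (Q j)" "U \<subseteq> (\<Union>j<n. Q j)"
  obtains d :: "'a \<Rightarrow> nat" where "\<And>x. x \<in> U \<Longrightarrow> d x < n \<and> x \<in> Q (d x)"
    "\<And>j. openin X {x\<in>U. d x = j}"
proof -
  define \<B> where "\<B> = {B. openin X B \<and> closedin X B \<and> (\<exists>j<n. B \<subseteq> Q j)}"
  have "U \<subseteq> \<Union>\<B>"
  proof
    fix x assume "x \<in> U"
    with Q(2) obtain j where j: "j < n" "x \<in> Q j" by blast
    obtain B where "openin X B" "closedin X B" "x \<in> B" "B \<subseteq> Q j"
      using zero_dimensional_space_neighborhood[OF X(1) Q(1)[OF j(1)] j(2)] .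
    with j show "x \<in> \<Union>\<B>" by (auto simp: \<B>_def)
  qed
  moreover have "compactin X U"
    using X U by (simp add: closedin_compact_space)
  ultimately obtain \<F> where \<F>: "finite \<F>" "\<F> \<subseteq> \<B>" "U \<subseteq> \<Union>\<F>"
    using compactinD[of X U \<B>] unfolding \<B>_def by blast
  define C where "C j = \<Union>{B\<in>\<F>. B \<subseteq> Q j}" for j
  have C: "openin X (C j)" "closedin X (C j)" for j
    unfolding C_def using \<F> by (auto simp: \<B>_def intro!: openin_Union closedin_Union)
  have ex: "\<exists>j<n. x \<in> C j" if x: "x \<in> U" for x
  proof -
    obtain B where "B \<in> \<F>" "x \<in> B" using x \<F>(3) by blast
    moreover from this obtain j where "j < n" "B \<subseteq> Q j" using \<F>(2) by (auto simp: \<B>_def)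
    ultimately show ?thesis by (auto simp: C_def)
  qed
  define d where "d x = (LEAST j. x \<in> C j)" for x
  have d_least: "x \<in> C j \<Longrightarrow> x \<in> C (d x)" "x \<in> C j \<Longrightarrow> d x \<le> j" for x j
    unfolding d_def by (fact LeastI, fact Least_le)
  have d: "d x < n" "x \<in> C (d x)" if x: "x \<in> U" for x
  proof -
    obtain j where j: "j < n" "x \<in> C j" using ex[OF x] by blast
    then show "x \<in> C (d x)" using d_least(1) by blast
    have "d x \<le> j" using j(2) by (rule d_least(2))
    with j(1) show "d x < n" by simp
  qed
  have eq: "{x\<in>U. d x = j} = U \<inter> C j - (\<Union>i<j. C i)" for j
  proof (intro set_eqI iffI)
    fix x assume x: "x \<in> {x\<in>U. d x = j}"
    then have "x \<in> C j" using d(2) by blast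
    moreover have "x \<notin> C i" if "i < j" for i
      using d_least(2)[of x i] x that by auto
    ultimately show "x \<in> U \<inter> C j - (\<Union>i<j. C i)" using x by blast
  next
    fix x assume x: "x \<in> U \<inter> C j - (\<Union>i<j. C i)"
    then have "d x \<le> j" "\<not> d x < j" using d_least[of x j] by auto
    with x show "x \<in> {x\<in>U. d x = j}" by simp
  qed
  have "openin X {x\<in>U. d x = j}" for j
    unfolding eq using C U by (intro openin_diff openin_Int closedin_Union) auto
  moreover have "x \<in> Q (d x)" if "x \<in> U" for x
    using d(2)[OF that] unfolding C_def by blast
  ultimately show ?thesis using that d(1) by blast
qed

lemma in_induced_graph_iff:
  "(x, y) \<in> induced_graph X f \<longleftrightarrow>
    (f x = Some y \<or> f y = Some x) \<and> \<not> (x = y \<and> x \<in> topspace X)"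
  by (auto simp: induced_graph_def Map.graph_def)

text \<open>This is where closedness of the domain enters. The preimage of a closed set is closed in
  the domain, hence in the space. Moreover the domain is compact, so images of closed sets are
  compact and therefore closed.\<close>
lemma closedin_neighbors:
  assumes X: "zdmc_space X" and f: "partial_continuous_injection X f"
    and D: "closedin X (dom f)" and W: "closedin X W"
  shows "closedin X ({x. \<exists>y\<in>W. f x = Some y} \<union> {y. \<exists>x\<in>W. f x = Some y})"
proof (rule closedin_Un)
  have cont: "continuous_map (subtopology X (dom f)) X (the \<circ> f)"
    using f by (simp add: partial_continuous_injection_def)
  have dom: "dom f \<subseteq> topspace X" using D closedin_subset by blast
  have "{x. \<exists>y\<in>W. f x = Some y} = {x \<in> topspace (subtopology X (dom f)). (the \<circ> f) x \<in> W}"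
    using dom by (auto simp: dom_def)
  then have "closedin (subtopology X (dom f)) {x. \<exists>y\<in>W. f x = Some y}"
    using closedin_continuous_map_preimage[OF cont W] by simp
  then show "closedin X {x. \<exists>y\<in>W. f x = Some y}"
    using D closedin_trans_full by blast
  have "compactin X (W \<inter> dom f)"
    using X W D by (auto simp: zdmc_space_def intro: closedin_compact_space)
  then have "compactin (subtopology X (dom f)) (W \<inter> dom f)"
    by (simp add: compactin_subtopology)
  then have "compactin X ((the \<circ> f) ` (W \<inter> dom f))"
    using cont by (rule image_compactin)
  moreover have "(the \<circ> f) ` (W \<inter> dom f) = {y. \<exists>x\<in>W. f x = Some y}"
    by (force simp: dom_def)
  moreover have "Hausdorff_space X"
    using X metrizable_imp_Hausdorff_space by (auto simp: zdmc_space_def)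
  ultimately show "closedin X {y. \<exists>x\<in>W. f x = Some y}"
    using compactin_imp_closedin by metis
qed

text \<open>By compactness a given coloring \<open>c\<^sub>0\<close> has finitely many classes, which are
  clopen and independent. They are recolored one after the other with three colors. A point \<open>x\<close>
  of the next class has at most two neighbors, its image and its preimage, so some color is
  free at \<open>x\<close>. Choosing a free color pointwise need not be continuous, but the set of points
  where a given color is forbidden is closed, because it consists of the neighbors of a closed set.
  So the sets where the three colors are allowed form an open cover of the class, and
  \<open>clopen_selection\<close> picks an allowed color continuously.\<close>
lemma colorable_three:
  assumes X: "zdmc_space X" and f: "partial_continuous_injection X f"
    and D: "closedin X (dom f)" and col: "colorable X (induced_graph X f) UNIV"
  shows "colorable X (induced_graph X f) {..<3}"
proof -
  let ?G = "induced_graph X f"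
  have sub: "?G \<subseteq> topspace X \<times> topspace X"
    using f by (simp add: induced_graph_subset partial_continuous_injection_def)
  have inj: "x = x'" if "f x = Some y" "f x' = Some y" for x x' y
    using f that unfolding partial_continuous_injection_def by (metis domI inj_onD)
  have X': "zero_dimensional_space X" "compact_space X"
    using X by (auto simp: zdmc_space_def)
  obtain n where "colorable X ?G {..<n}"
    using compact_space_colorable_finite[OF X'(2) col sub] .
  then obtain c\<^sub>0 where c\<^sub>0: "continuous_coloring X ?G {..<n} c\<^sub>0"
    by (auto simp: colorable_def)
  define V where "V k = {x \<in> topspace X. c\<^sub>0 x < k}" for k
  define U where "U k = {x \<in> topspace X. c\<^sub>0 x = k}" for k
  have cont: "continuous_map X (discrete_topology {..<n}) c\<^sub>0"
    using c\<^sub>0 by (simp add: continuous_coloring_def)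
  have clopen: "openin X {x \<in> topspace X. c\<^sub>0 x \<in> K} \<and> closedin X {x \<in> topspace X. c\<^sub>0 x \<in> K}" for K
  proof -
    have "{x \<in> topspace X. c\<^sub>0 x \<in> K} = {x \<in> topspace X. c\<^sub>0 x \<in> K \<inter> {..<n}}"
      using continuous_coloring_range[OF c\<^sub>0] by auto
    then show ?thesis
      using openin_continuous_map_preimage[OF cont, of "K \<inter> {..<n}"]
        closedin_continuous_map_preimage[OF cont, of "K \<inter> {..<n}"] by simp
  qed
  have V: "openin X (V k)" "closedin X (V k)" and U: "openin X (U k)" "closedin X (U k)" for k
    using clopen[of "{..<k}"] clopen[of "{k}"] by (simp_all add: V_def U_def)
  have "\<exists>c :: 'a \<Rightarrow> nat. (\<forall>x\<in>V k. c x < 3) \<and> (\<forall>j. openin X {x\<in>V k. c x = j}) \<and>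
    (\<forall>x\<in>V k. \<forall>y\<in>V k. (x, y) \<in> ?G \<longrightarrow> c x \<noteq> c y)" for k
  proof (induction k)
    case 0
    then show ?case by (simp add: V_def)
  next
    case (Suc k)
    then obtain c :: "'a \<Rightarrow> nat" where c: "\<And>x. x \<in> V k \<Longrightarrow> c x < 3"
        "\<And>j. openin X {x\<in>V k. c x = j}"
        "\<And>x y. x \<in> V k \<Longrightarrow> y \<in> V k \<Longrightarrow> (x, y) \<in> ?G \<Longrightarrow> c x \<noteq> c y"
      by blast
    define W where "W j = {x\<in>V k. c x = j}" for j
    define A where "A j = {x. \<exists>y\<in>W j. f x = Some y} \<union> {y. \<exists>x\<in>W j. f x = Some y}" for j
    have "closedin X (W j)" for j
    proof -
      have "W j = V k - (\<Union>i\<in>{..<3} - {j}. W i)"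
        using c(1) by (auto simp: W_def)
      moreover have "openin X (\<Union>i\<in>{..<3} - {j}. W i)"
        using c(2) by (auto simp: W_def)
      ultimately show ?thesis using V(2) closedin_diff by metis
    qed
    then have A: "closedin X (A j)" for j
      unfolding A_def by (intro closedin_neighbors[OF X f D])
    \<comment> \<open>Three colors among the neighbors of \<open>x\<close> would have to come from three different
      points, but \<open>x\<close> has at most one image and one preimage.\<close>
    have cover: "U k \<subseteq> (\<Union>j<3. topspace X - A j)"
    proof
      fix x assume x: "x \<in> U k"
      have False if "\<forall>j<3. x \<in> A j"
      proof -
        have "x \<in> A 0" "x \<in> A 1" "x \<in> A 2" using that by auto
        moreover have "\<exists>y\<in>W j. f x = Some y \<or> f y = Some x" if "x \<in> A j" for j
          using that unfolding A_def by blast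
        ultimately obtain y0 y1 y2 where "y0 \<in> W 0" "y1 \<in> W 1" "y2 \<in> W 2"
          and "f x = Some y0 \<or> f y0 = Some x" "f x = Some y1 \<or> f y1 = Some x"
            "f x = Some y2 \<or> f y2 = Some x"
          by metis
        moreover from this have "y0 \<noteq> y1" "y0 \<noteq> y2" "y1 \<noteq> y2" by (auto simp: W_def)
        ultimately show False using inj[of y0 x y1] inj[of y0 x y2] inj[of y1 x y2] by auto
      qed
      then show "x \<in> (\<Union>j<3. topspace X - A j)"
        using x by (auto simp: U_def)
    qed
    obtain d :: "'a \<Rightarrow> nat" where d: "\<And>x. x \<in> U k \<Longrightarrow> d x < 3 \<and> x \<in> topspace X - A (d x)"
        "\<And>j. openin X {x\<in>U k. d x = j}"
    proof (rule clopen_selection[OF X' U _ cover])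
      show "openin X (topspace X - A j)" for j using A by blast
    qed blast
    define c' where "c' x = (if x \<in> U k then d x else c x)" for x
    have VS: "V (Suc k) = V k \<union> U k" and disj: "V k \<inter> U k = {}"
      by (auto simp: V_def U_def less_Suc_eq)
    have c'V: "c' x = c x" if "x \<in> V k" for x
      using that disj by (auto simp: c'_def)
    have "\<forall>x\<in>V (Suc k). c' x < 3"
      using c(1) d(1) by (auto simp: VS c'_def)
    moreover have "openin X {x\<in>V (Suc k). c' x = j}" for j
    proof -
      have "{x\<in>V (Suc k). c' x = j} = {x\<in>V k. c x = j} \<union> {x\<in>U k. d x = j}"
        using disj by (auto simp: VS c'_def)
      then show ?thesis using c(2) d(2) by auto
    qed
    moreover have "c' x \<noteq> c' y" if xy: "x \<in> V (Suc k)" "y \<in> V (Suc k)" "(x, y) \<in> ?G" for x y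
    proof -
      have edge: "d u \<noteq> c v" if "u \<in> U k" "v \<in> V k" "f u = Some v \<or> f v = Some u" for u v
      proof
        assume "d u = c v"
        then have "u \<in> A (d u)" using that by (auto simp: A_def W_def)
        then show False using d(1)[OF that(1)] by simp
      qed
      have "c\<^sub>0 x \<noteq> c\<^sub>0 y" using c\<^sub>0 xy(3) by (auto simp: continuous_coloring_def)
      then have "x \<notin> U k \<or> y \<notin> U k" by (auto simp: U_def)
      with xy consider "x \<in> V k" "y \<in> V k" | "x \<in> V k" "y \<in> U k" | "x \<in> U k" "y \<in> V k"
        by (auto simp: VS)
      then show ?thesis
      proof cases
        case 1
        then show ?thesis using c(3) xy(3) by (simp add: c'V)
      next
        case 2
        then have "d y \<noteq> c x" using edge[of y x] xy(3) by (auto simp: in_induced_graph_iff)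
        with 2 show ?thesis using c'V[of x] by (simp add: c'_def)
      next
        case 3
        then have "d x \<noteq> c y" using edge[of x y] xy(3) by (auto simp: in_induced_graph_iff)
        with 3 show ?thesis using c'V[of y] by (simp add: c'_def)
      qed
    qed
    ultimately show ?case by blast
  qed
  then obtain c :: "'a \<Rightarrow> nat" where c: "\<forall>x\<in>V n. c x < 3" "\<forall>j. openin X {x\<in>V n. c x = j}"
      "\<forall>x\<in>V n. \<forall>y\<in>V n. (x, y) \<in> ?G \<longrightarrow> c x \<noteq> c y"
    by blast
  have "V n = topspace X"
    using continuous_coloring_range[OF c\<^sub>0] by (auto simp: V_def)
  with c sub have "continuous_coloring X ?G {..<3} c"
    by (auto simp: continuous_coloring_def continuous_map_into_discrete_iff)
  then show ?thesis by (auto simp: colorable_def)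
qed

section \<open>Finite values or the continuum\<close>
lemma chromatic_number_dichotomy:
  assumes "colorable X G UNIV \<Longrightarrow> colorable X G {..<n}" and G: "G \<subseteq> topspace X \<times> topspace X"
  shows "(\<exists>m\<le>n. \<chi>\<^sub>c X G =o natLeq_on m) \<or> \<chi>\<^sub>c X G =o continuum"
proof (cases "colorable X G UNIV")
  case True
  define m where "m = (LEAST m. colorable X G {..<m})"
  note col = assms(1)[OF True]
  have "colorable X G {..<m}"
    unfolding m_def by (rule LeastI[of "\<lambda>m. colorable X G {..<m}", OF col])
  moreover have least: "m \<le> k" if "colorable X G {..<k}" for k
    unfolding m_def by (rule Least_le[of "\<lambda>m. colorable X G {..<m}", OF that])
  ultimately have "\<chi>\<^sub>c X G =o natLeq_on m"
    by (rule continuous_chromatic_number_finite[OF _ G])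
  then show ?thesis using least[OF col] by blast
next
  case False
  then have "\<chi>\<^sub>c X G = continuum" using G by (rule continuous_chromatic_number_continuum)
  then show ?thesis using Card_order_cexp ordIso_refl by metis
qed

section \<open>A sum of convergent sequences\<close>
lemma homeomorphic_map_pullback_topology:
  assumes "bij_betw f A (topspace T)"
  shows "homeomorphic_map (pullback_topology A f T) T f"
proof (rule bijective_open_imp_homeomorphic_map)
  have top: "topspace (pullback_topology A f T) = A"
    using assms by (auto simp: topspace_pullback_topology bij_betw_def)
  show "continuous_map (pullback_topology A f T) T f"
    using continuous_map_pullback[OF continuous_map_id, of A f T] by simp
  show "open_map (pullback_topology A f T) T f"
    unfolding open_map_def
  proof (intro allI impI)
    fix S assume "openin (pullback_topology A f T) S"
    then obtain V where V: "openin T V" "S = f -` V \<inter> A"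
      by (auto simp: openin_pullback_topology)
    then have "f ` S = V"
      using assms openin_subset[OF V(1)] by (fastforce simp: bij_betw_def)
    with V show "openin T (f ` S)" by simp
  qed
  show "f ` topspace (pullback_topology A f T) = topspace T"
    and "inj_on f (topspace (pullback_topology A f T))"
    using assms by (auto simp: top bij_betw_def)
qed

text \<open>For \<open>m > 0\<close> the point \<open>pt i m\<close> is the \<open>m\<close>-th term of
  the \<open>i\<close>-th sequence, and \<open>pt i 0\<close> is its limit. With this choice the coordinate
  of \<open>pt i m\<close> on the real line is \<open>inverse (real m)\<close> without a case
  distinction, because \<open>inverse 0 = 0\<close>.\<close>
definition pt :: "nat \<Rightarrow> nat \<Rightarrow> nat" where
  "pt i m = prod_encode (i, m)"

lemma pt_eq_iff [simp]: "pt i m = pt j k \<longleftrightarrow> i = j \<and> m = k"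
  by (simp add: pt_def)

definition pts :: "nat set \<Rightarrow> nat set" where
  "pts I = {pt i m | i m. i \<in> I}"

lemma pt_in_pts_iff [simp]: "pt i m \<in> pts I \<longleftrightarrow> i \<in> I"
  by (auto simp: pts_def)

lemma pts_cases:
  assumes "x \<in> pts I"
  obtains i m where "x = pt i m" "i \<in> I"
  using assms by (auto simp: pts_def)

abbreviation reciprocals :: "real set" where
  "reciprocals \<equiv> range (\<lambda>m::nat. inverse (real m))"

definition sequence_product :: "nat set \<Rightarrow> (nat \<times> real) topology" where
  "sequence_product I = prod_topology (discrete_topology I) (top_of_set reciprocals)"

definition sequence_coord :: "nat \<Rightarrow> nat \<times> real" where
  "sequence_coord x = (case prod_decode x of (i, m) \<Rightarrow> (i, inverse (real m)))"

lemma sequence_coord_pt [simp]: "sequence_coord (pt i m) = (i, inverse (real m))"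
  by (simp add: sequence_coord_def pt_def)

text \<open>The topological sum of one convergent sequence for each index in \<open>I\<close>. It is pulled
  back from a product in order to inherit complete metrizability, and compactness if \<open>I\<close>
  is finite.\<close>
definition sequences :: "nat set \<Rightarrow> nat topology" where
  "sequences I = pullback_topology (pts I) sequence_coord (sequence_product I)"

lemma topspace_sequence_product: "topspace (sequence_product I) = I \<times> reciprocals"
  by (simp add: sequence_product_def)

lemma bij_betw_sequence_coord: "bij_betw sequence_coord (pts I) (topspace (sequence_product I))"
proof -
  have "inj_on sequence_coord (pts I)"
    by (auto simp: inj_on_def pts_def)
  moreover have "sequence_coord ` pts I = I \<times> reciprocals"
    by (force simp: pts_def image_iff)
  ultimately show ?thesis
    by (simp add: bij_betw_def topspace_sequence_product)
qed

lemma topspace_sequences [simp]: "topspace (sequences I) = pts I"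
  using bij_betw_sequence_coord[of I]
  by (auto simp: sequences_def topspace_pullback_topology bij_betw_def)

lemma sequences_homeomorphic: "sequences I homeomorphic_space sequence_product I"
  unfolding sequences_def
  using homeomorphic_map_pullback_topology[OF bij_betw_sequence_coord]
  by (rule homeomorphic_map_imp_homeomorphic_space)

lemma compact_reciprocals: "compact reciprocals"
proof -
  have "(\<lambda>m::nat. inverse (real m)) \<longlonglongrightarrow> 0"
    by (rule lim_inverse_n)
  then have "compact (insert 0 reciprocals)"
    by (rule compact_sequence_with_limit)
  moreover have "0 \<in> reciprocals" by (rule range_eqI[of _ _ 0]) simp
  ultimately show ?thesis by (simp add: insert_absorb)
qed

lemma completely_metrizable_sequences: "completely_metrizable_space (sequences I)"
proof -
  have "completely_metrizable_space (top_of_set reciprocals)"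
    using compact_reciprocals
    by (intro completely_metrizable_space_closedin completely_metrizable_space_euclidean)
      (simp add: compact_imp_closed)
  then have "completely_metrizable_space (sequence_product I)"
    by (simp add: sequence_product_def completely_metrizable_space_prod_topology
        completely_metrizable_space_discrete_topology)
  then show ?thesis
    using sequences_homeomorphic[of I] homeomorphic_completely_metrizable_space by blast
qed

lemma compact_sequences:
  assumes "finite I" shows "compact_space (sequences I)"
proof -
  have "compact_space (sequence_product I)"
    using assms compact_reciprocals
    by (simp add: sequence_product_def compact_space_prod_topology compact_space_discrete_topology
        compact_space_subtopology)
  then show ?thesis
    using sequences_homeomorphic[of I] homeomorphic_compact_space by blast
qed

text \<open>Only finitely many reciprocals lie above \<open>inverse (real (Suc m))\<close>, so the others
  among them can be removed from this open half-line.\<close>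
lemma openin_reciprocals_singleton:
  assumes "m > 0"
  shows "openin (top_of_set reciprocals) {inverse (real m)}"
proof -
  let ?T = "{inverse (real (Suc m))<..} - (\<lambda>k. inverse (real k)) ` {1..<m}"
  have "open ?T" by (intro open_Diff finite_imp_closed) auto
  moreover have "{inverse (real m)} = reciprocals \<inter> ?T"
  proof (intro set_eqI iffI)
    fix t assume "t \<in> {inverse (real m)}"
    then show "t \<in> reciprocals \<inter> ?T" using assms by auto
  next
    fix t assume t: "t \<in> reciprocals \<inter> ?T"
    then obtain k where k: "t = inverse (real k)" by blast
    have "0 < inverse (real (Suc m))" by simp
    with t have "0 < t" by (auto intro: less_trans)
    then have "k > 0" using k by (cases k) auto
    moreover from this have "k < Suc m" using t k by simp
    moreover have "\<not> k < m" using t k \<open>k > 0\<close> by auto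
    ultimately show "t \<in> {inverse (real m)}" using k by (simp add: less_Suc_eq)
  qed
  ultimately show ?thesis by (auto simp: openin_open)
qed

text \<open>From here on the topology is used only through this description: the terms of the
  sequences are isolated, and neighborhoods of a limit contain a tail of its sequence.\<close>
lemma openin_sequences:
  "openin (sequences I) U \<longleftrightarrow>
    U \<subseteq> pts I \<and> (\<forall>i. pt i 0 \<in> U \<longrightarrow> (\<exists>M. \<forall>m>M. pt i m \<in> U))"
proof (intro iffI conjI allI impI)
  assume U: "openin (sequences I) U"
  then show "U \<subseteq> pts I" using openin_subset by fastforce
  obtain V where V: "openin (sequence_product I) V" "U = sequence_coord -` V \<inter> pts I"
    using U by (auto simp: sequences_def openin_pullback_topology)
  fix i assume i: "pt i 0 \<in> U"
  then have iI: "i \<in> I" and "(i, 0) \<in> V" using V(2) by auto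
  obtain A B where AB: "openin (top_of_set reciprocals) B" "i \<in> A" "0 \<in> B" "A \<times> B \<subseteq> V"
    using openin_prod_topology_alt[THEN iffD1, rule_format,
        OF V(1)[unfolded sequence_product_def] \<open>(i, 0) \<in> V\<close>]
    by (elim exE conjE) (rule that)
  then obtain T where T: "open T" "B = reciprocals \<inter> T" by (auto simp: openin_open)
  have "eventually (\<lambda>m. inverse (real m) \<in> T) sequentially"
    using lim_inverse_n T AB(3) by (auto intro: topological_tendstoD)
  then obtain M where "\<forall>m\<ge>M. inverse (real m) \<in> T" by (auto simp: eventually_sequentially)
  then have "\<forall>m>M. pt i m \<in> U" using AB T V(2) iI by auto
  then show "\<exists>M. \<forall>m>M. pt i m \<in> U" by blast
next
  assume R: "U \<subseteq> pts I \<and> (\<forall>i. pt i 0 \<in> U \<longrightarrow> (\<exists>M. \<forall>m>M. pt i m \<in> U))"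
  have U: "x \<in> U \<longleftrightarrow> sequence_coord x \<in> sequence_coord ` U" if "x \<in> pts I" for x
    using inj_on_image_mem_iff[OF bij_betw_imp_inj_on[OF bij_betw_sequence_coord] that] R by simp
  have "openin (sequence_product I) (sequence_coord ` U)"
    unfolding sequence_product_def openin_prod_topology_alt
  proof (intro allI impI)
    fix i t assume "(i, t) \<in> sequence_coord ` U"
    then obtain x where x: "x \<in> U" "sequence_coord x = (i, t)" by (metis imageE)
    moreover obtain k m where "x = pt k m" "k \<in> I"
      using x R by (metis pts_cases subsetD)
    ultimately have m: "pt i m \<in> U" "i \<in> I" "t = inverse (real m)" by simp_all
    have "\<exists>B. openin (top_of_set reciprocals) B \<and> t \<in> B \<and> {i} \<times> B \<subseteq> sequence_coord ` U"
    proof (cases "m = 0")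
      case False
      moreover have "(i, t) \<in> sequence_coord ` U"
        using m by (intro image_eqI[of _ _ "pt i m"]) simp_all
      ultimately show ?thesis
        using m openin_reciprocals_singleton[of m] by (intro exI[of _ "{t}"]) simp
    next
      case True
      then obtain M where M: "\<forall>m>M. pt i m \<in> U" using R m by auto
      have sub: "pt i k \<in> U" if k: "inverse (real k) < inverse (real (Suc M))" for k
      proof (cases "k = 0")
        case True
        then show ?thesis using m \<open>m = 0\<close> by simp
      next
        case False
        then have "Suc M < k" using k by (simp del: of_nat_Suc)
        then show ?thesis using M by simp
      qed
      have "{i} \<times> (reciprocals \<inter> {..<inverse (real (Suc M))}) \<subseteq> sequence_coord ` U"
      proof
        fix p assume "p \<in> {i} \<times> (reciprocals \<inter> {..<inverse (real (Suc M))})"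
        then obtain k where "p = (i, inverse (real k))" "inverse (real k) < inverse (real (Suc M))"
          by blast
        then have "p = sequence_coord (pt i k)" "pt i k \<in> U" using sub by simp_all
        then show "p \<in> sequence_coord ` U" by blast
      qed
      moreover have "openin (top_of_set reciprocals) (reciprocals \<inter> {..<inverse (real (Suc M))})"
        by (rule openin_open_Int) simp
      moreover have "t \<in> reciprocals \<inter> {..<inverse (real (Suc M))}"
        using m True by auto
      ultimately show ?thesis by blast
    qed
    then show "\<exists>A B. openin (discrete_topology I) A \<and> openin (top_of_set reciprocals) B \<and>
        i \<in> A \<and> t \<in> B \<and> A \<times> B \<subseteq> sequence_coord ` U"
      using m(2) by (intro exI[of _ "{i}"]) simp
  qed
  moreover have "U = sequence_coord -` (sequence_coord ` U) \<inter> pts I"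
  proof (intro set_eqI iffI)
    fix x assume "x \<in> U"
    then show "x \<in> sequence_coord -` (sequence_coord ` U) \<inter> pts I" using R by blast
  next
    fix x assume "x \<in> sequence_coord -` (sequence_coord ` U) \<inter> pts I"
    then show "x \<in> U" using U[of x] by simp
  qed
  ultimately show "openin (sequences I) U"
    unfolding sequences_def openin_pullback_topology by blast
qed

lemma zero_dimensional_spaceI:
  assumes "\<And>U x. openin X U \<Longrightarrow> x \<in> U \<Longrightarrow> \<exists>B. openin X B \<and> closedin X B \<and> x \<in> B \<and> B \<subseteq> U"
  shows "zero_dimensional_space X"
  unfolding zero_dimensional_space_def
proof (intro exI conjI)
  show "openin X = arbitrary union_of (\<lambda>U. U \<in> {U. openin X U \<and> closedin X U})"
    using assms by (auto simp: openin_topology_base_unique)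
qed auto

lemma zero_dimensional_sequences: "zero_dimensional_space (sequences I)"
proof (rule zero_dimensional_spaceI)
  fix U x assume U: "openin (sequences I) U" "x \<in> U"
  then obtain i m where x: "x = pt i m" "i \<in> I"
    by (metis openin_subset pts_cases subsetD topspace_sequences)
  show "\<exists>B. openin (sequences I) B \<and> closedin (sequences I) B \<and> x \<in> B \<and> B \<subseteq> U"
  proof (cases "m = 0")
    case False
    have "\<exists>M. \<forall>k>M. pt i k \<noteq> x" unfolding x by (intro exI[of _ m]) auto
    then show ?thesis using U False x
      by (intro exI[of _ "{x}"]) (auto simp: closedin_def openin_sequences)
  next
    case True
    then obtain M where M: "\<forall>m>M. pt i m \<in> U"
      using U x by (auto simp: openin_sequences)
    let ?B = "{pt i m | m. m = 0 \<or> m > M}"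
    have "openin (sequences I) ?B" using x by (auto simp: openin_sequences)
    moreover have "closedin (sequences I) ?B" using x by (auto simp: closedin_def openin_sequences)
    ultimately show ?thesis using M U x True by (intro exI[of _ ?B]) auto
  qed
qed

lemma zdmc_sequences: "finite I \<Longrightarrow> zdmc_space (sequences I)"
  using zero_dimensional_sequences compact_sequences completely_metrizable_sequences
    completely_metrizable_imp_metrizable_space by (auto simp: zdmc_space_def)

lemma Polish_sequences: "Polish_space (sequences I)"
proof -
  have "separable_space (sequences I)"
    unfolding separable_space_def
    using closure_of_topspace[of "sequences I"] by (intro exI[of _ "pts I"]) auto
  then show ?thesis using completely_metrizable_sequences by (simp add: Polish_space_def)
qed

text \<open>A continuous coloring is constant near each limit. So edges between arbitrarily late terms
  of two sequences act like an edge between the two limits, and for \<open>i = j\<close> they rule out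
  continuous colorings altogether.\<close>
lemma coloring_separates_limits:
  assumes c: "continuous_coloring (sequences I) G K c" and ij: "i \<in> I" "j \<in> I"
    and edges: "\<And>M. \<exists>m>M. \<exists>n>M. (pt i m, pt j n) \<in> G"
  shows "c (pt i 0) \<noteq> c (pt j 0)"
proof
  assume eq: "c (pt i 0) = c (pt j 0)"
  have near: "\<exists>M. \<forall>m>M. c (pt k m) = c (pt k 0)" if "k \<in> I" for k
  proof -
    have "continuous_map (sequences I) (discrete_topology K) c"
      using c by (simp add: continuous_coloring_def)
    moreover have "c (pt k 0) \<in> K"
      using subsetD[OF continuous_coloring_range[OF c] imageI, of "pt k 0"] that by simp
    ultimately have "openin (sequences I) {x \<in> pts I. c x = c (pt k 0)}"
      by (simp add: continuous_map_into_discrete_iff)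
    then show ?thesis using that by (simp add: openin_sequences)
  qed
  obtain M N where M: "\<forall>m>M. c (pt i m) = c (pt i 0)" and N: "\<forall>m>N. c (pt j m) = c (pt j 0)"
    using near ij by blast
  obtain m n where mn: "m > max M N" "n > max M N" "(pt i m, pt j n) \<in> G"
    using edges by blast
  have "c (pt i m) = c (pt i 0)" using M mn(1) by simp
  also have "\<dots> = c (pt j n)" unfolding eq using N mn(2) by simp
  finally show False
    using c mn(3) by (auto simp: continuous_coloring_def)
qed

lemma openin_isolated: "S \<subseteq> {pt i (Suc m) | i m. i \<in> I} \<Longrightarrow> openin (sequences I) S"
  by (force simp: openin_sequences)

text \<open>Sets of isolated points are discrete, so on them there is no continuity to check.\<close>
lemma partial_homeomorphism_isolated:
  assumes dom: "dom f \<subseteq> {pt i (Suc m) | i m. i \<in> I}" and ran: "ran f \<subseteq> {pt i (Suc m) | i m. i \<in> I}"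
    and inj: "inj_on f (dom f)"
  shows "partial_homeomorphism (sequences I) f"
proof -
  have disc: "subtopology (sequences I) S = discrete_topology S"
    if "S \<subseteq> {pt i (Suc m) | i m. i \<in> I}" for S
  proof -
    have "S \<subseteq> pts I" using that by auto
    moreover have "openin (subtopology (sequences I) S) {x}" if "x \<in> S" for x
      using openin_subtopology_Int[OF openin_isolated, of "{x}" I S] that
        \<open>S \<subseteq> {pt i (Suc m) | i m. i \<in> I}\<close> by auto
    ultimately have "discrete_topology S = subtopology (sequences I) S"
      by (subst discrete_topology_unique) auto
    then show ?thesis by simp
  qed
  have im: "ran f = (the \<circ> f) ` dom f"
    by (force simp: dom_def ran_def)
  have "inj_on (the \<circ> f) (dom f)"
    using inj by (auto simp: inj_on_def dom_def)
  then have "homeomorphic_map (discrete_topology (dom f)) (discrete_topology (ran f)) (the \<circ> f)"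
    by (intro bijective_open_imp_homeomorphic_map) (auto simp: open_map_def im simp del: comp_apply)
  then show ?thesis
    using dom ran by (auto simp: partial_homeomorphism_def partial_function_on_def disc)
qed

section \<open>A complete graph on the limits\<close>

text \<open>For each pair \<open>i < j\<close> from \<open>I\<close>, infinitely many terms of the
  \<open>i\<close>-th sequence are matched with terms of the \<open>j\<close>-th one. The index of a term
  encodes the partner sequence and a counter; shifting it by \<open>Suc\<close> keeps the limits out.\<close>
definition matching :: "nat set \<Rightarrow> nat \<rightharpoonup> nat" where
  "matching I x = (case prod_decode x of (i, m) \<Rightarrow> (case m of 0 \<Rightarrow> None | Suc p \<Rightarrow>
     (case prod_decode p of (j, k) \<Rightarrow>
       if i \<in> I \<and> j \<in> I \<and> i < j then Some (pt j (Suc (prod_encode (i, k)))) else None)))"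

lemma matching_eq_Some_iff:
  "matching I x = Some y \<longleftrightarrow> (\<exists>i\<in>I. \<exists>j\<in>I. \<exists>k. i < j \<and>
     x = pt i (Suc (prod_encode (j, k))) \<and> y = pt j (Suc (prod_encode (i, k))))"
proof
  assume y: "matching I x = Some y"
  obtain i m where im: "prod_decode x = (i, m)" by fastforce
  then have x: "x = pt i m" using prod_decode_inverse[of x] by (simp add: pt_def)
  obtain p where p: "m = Suc p"
    using y im by (cases m) (auto simp: matching_def)
  obtain j k where jk: "prod_decode p = (j, k)" by fastforce
  then have "p = prod_encode (j, k)" using prod_decode_inverse[of p] by simp
  moreover have "i \<in> I" "j \<in> I" "i < j" "y = pt j (Suc (prod_encode (i, k)))"
    using y im p jk by (auto simp: matching_def split: if_splits)
  ultimately show "\<exists>i\<in>I. \<exists>j\<in>I. \<exists>k. i < j \<and>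
     x = pt i (Suc (prod_encode (j, k))) \<and> y = pt j (Suc (prod_encode (i, k)))"
    using x p by blast
next
  assume "\<exists>i\<in>I. \<exists>j\<in>I. \<exists>k. i < j \<and>
     x = pt i (Suc (prod_encode (j, k))) \<and> y = pt j (Suc (prod_encode (i, k)))"
  then show "matching I x = Some y" by (auto simp: matching_def pt_def)
qed

lemma dom_matching: "dom (matching I) \<subseteq> {pt i (Suc m) | i m. i \<in> I}"
proof
  fix x assume "x \<in> dom (matching I)"
  then obtain y where "matching I x = Some y" by blast
  then show "x \<in> {pt i (Suc m) | i m. i \<in> I}"
    unfolding matching_eq_Some_iff by blast
qed

lemma ran_matching: "ran (matching I) \<subseteq> {pt i (Suc m) | i m. i \<in> I}"
proof
  fix y assume "y \<in> ran (matching I)"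
  then obtain x where "matching I x = Some y" by (auto simp: ran_def)
  then show "y \<in> {pt i (Suc m) | i m. i \<in> I}"
    unfolding matching_eq_Some_iff by blast
qed

lemma partial_homeomorphism_matching: "partial_homeomorphism (sequences I) (matching I)"
proof (rule partial_homeomorphism_isolated[OF dom_matching ran_matching])
  show "inj_on (matching I) (dom (matching I))"
  proof (rule inj_onI)
    fix x x' assume "x \<in> dom (matching I)" and eq: "matching I x = matching I x'"
    then obtain y where "matching I x = Some y" by blast
    moreover from this have "matching I x' = Some y" using eq by simp
    ultimately show "x = x'"
      unfolding matching_eq_Some_iff by (elim bexE exE conjE) (simp add: prod_encode_eq)
  qed
qed

lemma fixed_point_free_matching: "fixed_point_free (matching I)"
  by (auto simp: fixed_point_free_def matching_eq_Some_iff)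

lemma induced_graph_sequences_subset:
  "partial_homeomorphism (sequences I) f \<Longrightarrow>
    induced_graph (sequences I) f \<subseteq> topspace (sequences I) \<times> topspace (sequences I)"
  by (intro induced_graph_subset) (simp add: partial_homeomorphism_def)

text \<open>Each sequence, together with its limit, is clopen and contains no edge.\<close>
lemma coloring_matching:
  "colorable (sequences I) (induced_graph (sequences I) (matching I)) I"
proof -
  define c where "c x = fst (prod_decode x)" for x :: nat
  have c: "c (pt i m) = i" for i m by (simp add: c_def pt_def)
  have "openin (sequences I) {x \<in> pts I. c x = i}" if "i \<in> I" for i
    using that c by (auto simp: openin_sequences)
  moreover have "c ` pts I \<subseteq> I" by (auto simp: c pts_def)
  moreover have "c x \<noteq> c y" if "(x, y) \<in> induced_graph (sequences I) (matching I)" for x y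
    using that by (auto simp: in_induced_graph_iff matching_eq_Some_iff c)
  ultimately have "continuous_coloring (sequences I) (induced_graph (sequences I) (matching I)) I c"
    by (auto simp: continuous_coloring_def continuous_map_into_discrete_iff)
  then show ?thesis by (auto simp: colorable_def)
qed

text \<open>The limits are isolated vertices of the graph, but any two of them must get different
  colors, because their sequences are joined by edges arbitrarily close to them.\<close>
lemma coloring_matching_inj_on:
  assumes c: "continuous_coloring (sequences I) (induced_graph (sequences I) (matching I)) K c"
  shows "inj_on (\<lambda>i. c (pt i 0)) I"
proof (rule linorder_inj_onI')
  fix i j assume ij: "i \<in> I" "j \<in> I" "i < j"
  show "c (pt i 0) \<noteq> c (pt j 0)"
  proof (rule coloring_separates_limits[OF c ij(1,2)])
    fix M :: nat
    have "matching I (pt i (Suc (prod_encode (j, M)))) = Some (pt j (Suc (prod_encode (i, M))))"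
      using ij by (auto simp: matching_eq_Some_iff)
    then have "(pt i (Suc (prod_encode (j, M))), pt j (Suc (prod_encode (i, M))))
        \<in> induced_graph (sequences I) (matching I)"
      using ij by (simp add: in_induced_graph_iff)
    moreover have "M < Suc (prod_encode (j, M))" "M < Suc (prod_encode (i, M))"
      by (simp_all add: le_imp_less_Suc le_prod_encode_2)
    ultimately show "\<exists>m>M. \<exists>n>M. (pt i m, pt j n) \<in> induced_graph (sequences I) (matching I)"
      by blast
  qed
qed

lemma colorable_matching_card_le:
  assumes "colorable (sequences I) (induced_graph (sequences I) (matching I)) {..<m}"
  shows "finite I \<and> card I \<le> m"
proof -
  obtain c where c: "continuous_coloring (sequences I)
      (induced_graph (sequences I) (matching I)) {..<m} c"
    using assms by (auto simp: colorable_def)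
  have "(\<lambda>i. c (pt i 0)) ` I \<subseteq> {..<m}"
    using continuous_coloring_range[OF c] by (force simp: image_subset_iff)
  with coloring_matching_inj_on[OF c] show ?thesis
    by (metis card_inj_on_le card_lessThan finite_lessThan inj_on_finite)
qed

lemma chromatic_number_matching_finite:
  "\<chi>\<^sub>c (sequences {..<n}) (induced_graph (sequences {..<n}) (matching {..<n})) =o natLeq_on n"
  by (rule continuous_chromatic_number_finite[OF coloring_matching
        induced_graph_sequences_subset[OF partial_homeomorphism_matching]])
    (use colorable_matching_card_le in force)

lemma chromatic_number_matching_countable:
  "\<chi>\<^sub>c (sequences UNIV) (induced_graph (sequences UNIV) (matching UNIV)) =o natLeq"
  by (rule continuous_chromatic_number_countable[OF coloring_matching
        induced_graph_sequences_subset[OF partial_homeomorphism_matching]])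
    (use colorable_matching_card_le[of UNIV] in auto)

section \<open>No continuous coloring at all\<close>

text \<open>On a single sequence, consecutive terms \<open>2k + 1\<close> and \<open>2k + 2\<close> are
  exchanged and the limit stays fixed. This is a homeomorphism of the whole space. Its restriction
  to the odd terms induces the same graph, but has no fixed point and an open domain.\<close>
definition partner :: "nat \<Rightarrow> nat" where
  "partner m = (if m = 0 then 0 else if odd m then m + 1 else m - 1)"

lemma partner_partner [simp]: "partner (partner m) = m"
  by (auto simp: partner_def)

lemma partner_0 [simp]: "partner 0 = 0"
  by (simp add: partner_def)

lemma partner_ge: "m \<le> Suc (partner m)"
  by (simp add: partner_def)

definition swap :: "nat \<Rightarrow> nat" where
  "swap x = (case prod_decode x of (i, m) \<Rightarrow> pt i (partner m))"

lemma swap_pt [simp]: "swap (pt i m) = pt i (partner m)"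
  by (simp add: swap_def pt_def)

definition half_swap :: "nat \<rightharpoonup> nat" where
  "half_swap x = (if x \<in> range (\<lambda>k. pt 0 (2 * k + 1)) then Some (swap x) else None)"

lemma half_swap_eq_Some_iff:
  "half_swap x = Some y \<longleftrightarrow> (\<exists>k. x = pt 0 (2 * k + 1) \<and> y = pt 0 (2 * k + 2))"
  by (auto simp: half_swap_def partner_def)

definition full_swap :: "nat \<rightharpoonup> nat" where
  "full_swap x = (if x \<in> pts {0} then Some (swap x) else None)"

lemma half_swap_partial_homeomorphism:
  "partial_homeomorphism (sequences {0}) half_swap" "openin (sequences {0}) (dom half_swap)"
proof -
  have "x \<in> {pt i (Suc m) | i m. i \<in> {0}}" if "half_swap x = Some y" for x y
    using that unfolding half_swap_eq_Some_iff by auto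
  then have dom: "dom half_swap \<subseteq> {pt i (Suc m) | i m. i \<in> {0}}" by blast
  have "y \<in> {pt i (Suc m) | i m. i \<in> {0}}" if "half_swap x = Some y" for x y
    using that unfolding half_swap_eq_Some_iff by auto
  then have ran: "ran half_swap \<subseteq> {pt i (Suc m) | i m. i \<in> {0}}"
    unfolding ran_def by blast
  have "inj_on half_swap (dom half_swap)"
  proof (rule inj_onI)
    fix x x' assume "x \<in> dom half_swap" and eq: "half_swap x = half_swap x'"
    then obtain y where "half_swap x = Some y" by blast
    moreover from this have "half_swap x' = Some y" using eq by simp
    ultimately show "x = x'" unfolding half_swap_eq_Some_iff by auto
  qed
  then show "partial_homeomorphism (sequences {0}) half_swap"
    using dom ran partial_homeomorphism_isolated by blast
  show "openin (sequences {0}) (dom half_swap)" using dom by (rule openin_isolated)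
qed

lemma fixed_point_free_half_swap: "fixed_point_free half_swap"
  by (auto simp: fixed_point_free_def half_swap_eq_Some_iff)

lemma total_homeomorphism_full_swap: "total_homeomorphism (sequences {0}) full_swap"
proof -
  have inv: "swap x \<in> pts {0}" "swap (swap x) = x" if "x \<in> pts {0}" for x
    using that by (auto elim!: pts_cases)
  have dom: "dom full_swap = pts {0}" by (auto simp: full_swap_def dom_def)
  have ran: "ran full_swap = pts {0}"
    using inv by (force simp: full_swap_def ran_def)
  have "continuous_map (sequences {0}) (sequences {0}) swap"
    unfolding continuous_map_def
  proof (intro conjI allI impI)
    show "swap \<in> topspace (sequences {0}) \<rightarrow> topspace (sequences {0})" using inv by auto
    fix U assume U: "openin (sequences {0}) U"
    show "openin (sequences {0}) {x \<in> topspace (sequences {0}). swap x \<in> U}"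
      unfolding openin_sequences
    proof (intro conjI allI impI)
      fix i assume "pt i 0 \<in> {x \<in> topspace (sequences {0}). swap x \<in> U}"
      then have i: "i = 0" "pt 0 0 \<in> U" by auto
      then obtain M where M: "\<forall>m>M. pt 0 m \<in> U"
        using U by (auto simp: openin_sequences)
      have "pt i m \<in> {x \<in> topspace (sequences {0}). swap x \<in> U}" if "m > Suc M" for m
        using M[rule_format, of "partner m"] partner_ge[of m] that i by simp
      then show "\<exists>M. \<forall>m>M. pt i m \<in> {x \<in> topspace (sequences {0}). swap x \<in> U}" by blast
    qed auto
  qed
  then have "homeomorphic_map (sequences {0}) (sequences {0}) swap"
    by (rule homeomorphic_map_involution) (simp add: inv)
  then have "homeomorphic_map (sequences {0}) (sequences {0}) (the \<circ> full_swap)"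
    by (rule homeomorphic_map_eq) (simp add: full_swap_def)
  moreover have "subtopology (sequences {0}) (pts {0}) = sequences {0}"
    by (metis subtopology_topspace topspace_sequences)
  ultimately show ?thesis
    by (simp add: total_homeomorphism_def partial_homeomorphism_def partial_function_on_def dom ran)
qed

lemma chromatic_number_swap:
  assumes f: "partial_homeomorphism (sequences {0}) f"
    and edges: "\<And>k. f (pt 0 (2 * k + 1)) = Some (pt 0 (2 * k + 2))"
  shows "\<chi>\<^sub>c (sequences {0}) (induced_graph (sequences {0}) f) = continuum"
proof (rule continuous_chromatic_number_continuum[OF _ induced_graph_sequences_subset[OF f]])
  show "\<not> colorable (sequences {0}) (induced_graph (sequences {0}) f) UNIV"
  proof
    assume "colorable (sequences {0}) (induced_graph (sequences {0}) f) UNIV"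
    then obtain c :: "nat \<Rightarrow> nat"
      where c: "continuous_coloring (sequences {0}) (induced_graph (sequences {0}) f) UNIV c"
      by (auto simp: colorable_def)
    have "\<exists>m>M. \<exists>n>M. (pt 0 m, pt 0 n) \<in> induced_graph (sequences {0}) f" for M
      using edges[of M]
      by (intro exI[of _ "2 * M + 1"] conjI exI[of _ "2 * M + 2"]) (auto simp: in_induced_graph_iff)
    then have "c (pt 0 0) \<noteq> c (pt 0 0)"
      by (intro coloring_separates_limits[OF c]) auto
    then show False by simp
  qed
qed

section \<open>Finite cycles\<close>

text \<open>A cycle of length at most three is a complete graph; a cycle of length one is a fixed
  point and contributes no edge.\<close>
definition cycle :: "nat \<Rightarrow> nat \<rightharpoonup> nat" where
  "cycle n x = (if x < n then Some (if Suc x = n then 0 else Suc x) else None)"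

lemma zdmc_discrete: "finite S \<Longrightarrow> zdmc_space (discrete_topology S)"
  by (auto simp: zdmc_space_def compact_space_discrete_topology intro!: zero_dimensional_spaceI)

lemma total_homeomorphism_cycle: "total_homeomorphism (discrete_topology {..<n}) (cycle n)"
proof -
  have dom: "dom (cycle n) = {..<n}" by (auto simp: cycle_def dom_def)
  have im: "(the \<circ> cycle n) ` {..<n} = {..<n}"
  proof (intro set_eqI iffI)
    fix y assume "y \<in> {..<n}"
    then show "y \<in> (the \<circ> cycle n) ` {..<n}"
      by (intro image_eqI[of _ _ "if y = 0 then n - 1 else y - 1"]) (auto simp: cycle_def)
  qed (auto simp: cycle_def)
  have "ran (cycle n) = (the \<circ> cycle n) ` dom (cycle n)"
    by (force simp: dom_def ran_def)
  then have ran: "ran (cycle n) = {..<n}" by (simp only: dom im)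
  have "inj_on (the \<circ> cycle n) {..<n}"
    by (auto simp: inj_on_def cycle_def split: if_splits)
  then have "homeomorphic_map (discrete_topology {..<n}) (discrete_topology {..<n}) (the \<circ> cycle n)"
    using im by (intro bijective_open_imp_homeomorphic_map) (auto simp: open_map_def simp del: comp_apply)
  then show ?thesis
    by (simp add: total_homeomorphism_def partial_homeomorphism_def partial_function_on_def dom ran)
qed

lemma chromatic_number_cycle:
  assumes "n \<le> 3"
  shows "\<chi>\<^sub>c (discrete_topology {..<n}) (induced_graph (discrete_topology {..<n}) (cycle n)) =o natLeq_on n"
    (is "\<chi>\<^sub>c ?X ?G =o natLeq_on n")
proof (rule continuous_chromatic_number_finite)
  show sub: "?G \<subseteq> topspace ?X \<times> topspace ?X"
    using total_homeomorphism_cycle[of n]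
    by (intro induced_graph_subset) (simp add: total_homeomorphism_def partial_homeomorphism_def)
  have "continuous_coloring ?X ?G {..<n} id"
    using sub by (auto simp: continuous_coloring_def in_induced_graph_iff)
  then show "colorable ?X ?G {..<n}" by (auto simp: colorable_def)
  fix m assume "colorable ?X ?G {..<m}"
  then obtain c where c: "continuous_coloring ?X ?G {..<m} c" by (auto simp: colorable_def)
  have edge: "(x, y) \<in> ?G" if "x < n" "y < n" "x \<noteq> y" for x y
  proof -
    have "x \<in> {0, 1, 2}" "y \<in> {0, 1, 2}" "n \<in> {1, 2, 3}" using that assms by auto
    with that show ?thesis by (auto simp: in_induced_graph_iff cycle_def)
  qed
  have "inj_on c {..<n}"
    using c edge unfolding continuous_coloring_def inj_on_def by blast
  moreover have "c ` {..<n} \<subseteq> {..<m}" using continuous_coloring_range[OF c] by simp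
  ultimately show "n \<le> m" by (metis card_inj_on_le card_lessThan finite_lessThan)
qed

section \<open>The values of the continuous chromatic number\<close>
theorem theorem1p10:
  shows "
    ((\<forall>(X :: 'a topology) f.
        zdmc_space X \<and> partial_continuous_injection X f \<and> openin X (dom f) \<longrightarrow>
        (\<exists>n::nat. \<chi>\<^sub>c X (induced_graph X f) =o natLeq_on n) \<or>
        \<chi>\<^sub>c X (induced_graph X f) =o continuum) \<and>
     (\<forall>\<kappa> :: (nat \<Rightarrow> bool) rel. (\<exists>n::nat. \<kappa> =o natLeq_on n) \<or> \<kappa> =o continuum \<longrightarrow>
        (\<exists>(X :: nat topology) f.
           countable (topspace X) \<and> zdmc_space X \<and>
           partial_homeomorphism X f \<and> openin X (dom f) \<and> fixed_point_free f \<and>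
           \<chi>\<^sub>c X (induced_graph X f) =o \<kappa>))) \<and>
    ((\<forall>(X :: 'a topology) f.
        zdmc_space X \<and> partial_continuous_injection X f \<and> closedin X (dom f) \<longrightarrow>
        (\<exists>n\<in>{0, 1, 2, 3::nat}. \<chi>\<^sub>c X (induced_graph X f) =o natLeq_on n) \<or>
        \<chi>\<^sub>c X (induced_graph X f) =o continuum) \<and>
     (\<forall>\<kappa> :: (nat \<Rightarrow> bool) rel. (\<exists>n\<in>{0, 1, 2, 3::nat}. \<kappa> =o natLeq_on n) \<or> \<kappa> =o continuum \<longrightarrow>
        (\<exists>(X :: nat topology) f.
           countable (topspace X) \<and> zdmc_space X \<and> total_homeomorphism X f \<and>
           \<chi>\<^sub>c X (induced_graph X f) =o \<kappa>))) \<and>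
    (\<exists>(X :: nat topology) f.
        countable (topspace X) \<and> Polish_space X \<and>
        partial_homeomorphism X f \<and> openin X (dom f) \<and> fixed_point_free f \<and>
        \<chi>\<^sub>c X (induced_graph X f) =o natLeq)"
proof (intro conjI allI impI)
  fix X :: "'a topology" and f
  assume "zdmc_space X \<and> partial_continuous_injection X f \<and> openin X (dom f)"
  then have X: "compact_space X" and sub: "induced_graph X f \<subseteq> topspace X \<times> topspace X"
    by (auto simp: zdmc_space_def partial_continuous_injection_def dest: induced_graph_subset)
  show "(\<exists>n::nat. \<chi>\<^sub>c X (induced_graph X f) =o natLeq_on n) \<or> \<chi>\<^sub>c X (induced_graph X f) =o continuum"
  proof (cases "colorable X (induced_graph X f) UNIV")
    case True
    then obtain n where "colorable X (induced_graph X f) {..<n}"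
      using compact_space_colorable_finite[OF X _ sub] by blast
    then show ?thesis using chromatic_number_dichotomy[of X _ n, OF _ sub] by blast
  next
    case False
    then show ?thesis using chromatic_number_dichotomy[of X _ 0, OF _ sub] by blast
  qed
next
  fix \<kappa> :: "(nat \<Rightarrow> bool) rel"
  assume "(\<exists>n::nat. \<kappa> =o natLeq_on n) \<or> \<kappa> =o continuum"
  then show "\<exists>(X :: nat topology) f.
           countable (topspace X) \<and> zdmc_space X \<and>
           partial_homeomorphism X f \<and> openin X (dom f) \<and> fixed_point_free f \<and>
           \<chi>\<^sub>c X (induced_graph X f) =o \<kappa>"
  proof (elim disjE exE)
    fix n assume "\<kappa> =o natLeq_on n"
    then have "\<chi>\<^sub>c (sequences {..<n}) (induced_graph (sequences {..<n}) (matching {..<n})) =o \<kappa>"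
      using chromatic_number_matching_finite ordIso_symmetric ordIso_transitive by blast
    then show ?thesis
      using zdmc_sequences[of "{..<n}"] partial_homeomorphism_matching fixed_point_free_matching
        openin_isolated[OF dom_matching]
      by (intro exI[of _ "sequences {..<n}"] exI[of _ "matching {..<n}"]) simp
  next
    assume "\<kappa> =o continuum"
    moreover have "\<chi>\<^sub>c (sequences {0}) (induced_graph (sequences {0}) half_swap) = continuum"
      by (intro chromatic_number_swap half_swap_partial_homeomorphism)
        (simp add: half_swap_eq_Some_iff)
    ultimately have "\<chi>\<^sub>c (sequences {0}) (induced_graph (sequences {0}) half_swap) =o \<kappa>"
      using ordIso_symmetric by metis
    then show ?thesis
      using zdmc_sequences[of "{0}"] half_swap_partial_homeomorphism fixed_point_free_half_swap
      by (intro exI[of _ "sequences {0}"] exI[of _ half_swap]) simp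
  qed
next
  fix X :: "'a topology" and f
  assume X: "zdmc_space X \<and> partial_continuous_injection X f \<and> closedin X (dom f)"
  then have "induced_graph X f \<subseteq> topspace X \<times> topspace X"
    by (auto simp: partial_continuous_injection_def dest: induced_graph_subset)
  then have "(\<exists>m\<le>3. \<chi>\<^sub>c X (induced_graph X f) =o natLeq_on m) \<or>
      \<chi>\<^sub>c X (induced_graph X f) =o continuum"
    using X colorable_three by (intro chromatic_number_dichotomy) blast+
  moreover have "m \<in> {0, 1, 2, 3}" if "m \<le> 3" for m :: nat using that by auto
  ultimately show "(\<exists>n\<in>{0, 1, 2, 3::nat}. \<chi>\<^sub>c X (induced_graph X f) =o natLeq_on n) \<or>
        \<chi>\<^sub>c X (induced_graph X f) =o continuum" by blast
next
  fix \<kappa> :: "(nat \<Rightarrow> bool) rel"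
  assume "(\<exists>n\<in>{0, 1, 2, 3::nat}. \<kappa> =o natLeq_on n) \<or> \<kappa> =o continuum"
  then show "\<exists>(X :: nat topology) f.
           countable (topspace X) \<and> zdmc_space X \<and> total_homeomorphism X f \<and>
           \<chi>\<^sub>c X (induced_graph X f) =o \<kappa>"
  proof (elim disjE bexE)
    fix n :: nat assume n: "n \<in> {0, 1, 2, 3}" and "\<kappa> =o natLeq_on n"
    moreover from n have "n \<le> 3" by auto
    ultimately have "\<chi>\<^sub>c (discrete_topology {..<n})
        (induced_graph (discrete_topology {..<n}) (cycle n)) =o \<kappa>"
      using chromatic_number_cycle ordIso_symmetric ordIso_transitive by blast
    then show ?thesis
      using zdmc_discrete[of "{..<n}"] total_homeomorphism_cycle
      by (intro exI[of _ "discrete_topology {..<n}"] exI[of _ "cycle n"]) simp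
  next
    assume "\<kappa> =o continuum"
    moreover have "\<chi>\<^sub>c (sequences {0}) (induced_graph (sequences {0}) full_swap) = continuum"
      using total_homeomorphism_full_swap
      by (intro chromatic_number_swap) (simp_all add: total_homeomorphism_def full_swap_def partner_def)
    ultimately have "\<chi>\<^sub>c (sequences {0}) (induced_graph (sequences {0}) full_swap) =o \<kappa>"
      using ordIso_symmetric by metis
    then show ?thesis
      using zdmc_sequences[of "{0}"] total_homeomorphism_full_swap
      by (intro exI[of _ "sequences {0}"] exI[of _ full_swap]) simp
  qed
next
  show "\<exists>(X :: nat topology) f.
        countable (topspace X) \<and> Polish_space X \<and>
        partial_homeomorphism X f \<and> openin X (dom f) \<and> fixed_point_free f \<and>
        \<chi>\<^sub>c X (induced_graph X f) =o natLeq"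
    using Polish_sequences[of UNIV] partial_homeomorphism_matching fixed_point_free_matching
      openin_isolated[OF dom_matching] chromatic_number_matching_countable
    by (intro exI[of _ "sequences UNIV"] exI[of _ "matching UNIV"]) simp
qed

end
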